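(* There exists a convex body $K\subset\mathbb{R}^{15}$ which is a $2$-tangential body of the unit ball $B_{15}$ and such that the Steiner polynomial $f(K,B_{15},s)=\sum_{i=0}^{15}\binom{15}{i}\mathrm{W}_i(K;B_{15})\,s^i$ has a complex root with positive real part.
   Context: A convex body is a compact convex set in $\mathbb{R}^n$; $B_n$ is the Euclidean unit ball of $\mathbb{R}^n$. For convex bodies $K,E\subset\mathbb{R}^n$, the relative quermassintegrals $\mathrm{W}_i(K;E)$, $0\le i\le n$, are the coefficients defined by $\mathrm{V}(K+\rho E)=\sum_{i=0}^n\binom{n}{i}\mathrm{W}_i(K;E)\rho^i$ for all $\rho\ge0$, where $\mathrm{V}$ is $n$-dimensional Lebesgue measure. The Steiner polynomial $f(K,E,s)=\sum_{i=0}^n\binom{n}{i}\mathrm{W}_i(K;E)s^i$ is regarded as a polynomial in the complex variable $s$. Tangential bodies: a boundary point $x$ of $K$ is an $r$-singular point of $K$ if the normal cone of $K$ at $x$ has dimension at least $n-r$. For $p\in\{0,\dots,n-1\}$, a convex body $K$ containing the convex body $E$ is called a $p$-tangential body of $E$ if each support hyperplane of $K$ that is not a support hyperplane of $E$ contains only $(p-1)$-singular points of $K$ (i.e. every point of $K$ in that hyperplane is a $(p-1)$-singular point of $K$). *)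

theory Defs
  imports "HOL-Analysis.Analysis" "HOL-Computational_Algebra.Polynomial"
begin

definition convex_body :: "'a::euclidean_space set \<Rightarrow> bool" where
  "convex_body K \<longleftrightarrow> compact K \<and> convex K"

text \<open>
  The sum of sets is the Minkowski sum. The clause for indices above the dimension only pins
  down the irrelevant values of the sequence, so that it is determined uniquely
  (see \<open>quermassintegral_eqI\<close>).
\<close>

definition steiner_coeffs :: "'a::euclidean_space set \<Rightarrow> 'a set \<Rightarrow> (nat \<Rightarrow> real) \<Rightarrow> bool" where
  "steiner_coeffs K E w \<longleftrightarrow>
     (\<forall>i > DIM('a). w i = 0) \<and>
     (\<forall>\<rho> \<ge> 0. measure lebesgue (K + (\<lambda>y. \<rho> *\<^sub>R y) ` E)
              = (\<Sum>i\<le>DIM('a). real (DIM('a) choose i) * w i * \<rho> ^ i))"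

definition quermassintegral :: "'a::euclidean_space set \<Rightarrow> 'a set \<Rightarrow> nat \<Rightarrow> real" where
  "quermassintegral K E = (THE w. steiner_coeffs K E w)"

definition steiner_poly :: "'a::euclidean_space set \<Rightarrow> 'a set \<Rightarrow> complex poly" where
  "steiner_poly K E =
     (\<Sum>i\<le>DIM('a). monom (of_real (real (DIM('a) choose i) * quermassintegral K E i)) i)"

lemma steiner_coeffs_unique:
  fixes K E :: "'a::euclidean_space set"
  assumes v: "steiner_coeffs K E v" and w: "steiner_coeffs K E w"
  shows "v = w"
proof
  fix i
  let ?n = "DIM('a)"
  let ?p = "\<lambda>u::nat \<Rightarrow> real. \<Sum>i\<le>?n. monom (real (?n choose i) * u i) i"
  have "poly (?p v - ?p w) x = 0" if "x \<ge> 0" for x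
    using that v w by (simp add: steiner_coeffs_def poly_sum poly_monom)
  then have "{0..} \<subseteq> {x. poly (?p v - ?p w) x = 0}"
    by auto
  moreover have "infinite {0::real..}"
    by (simp add: infinite_Ici)
  ultimately have "?p v - ?p w = 0"
    using poly_roots_finite finite_subset by blast
  then have eq: "coeff (?p v) i = coeff (?p w) i"
    by simp
  show "v i = w i"
  proof (cases "i \<le> ?n")
    case True
    then show ?thesis
      using eq by (simp add: coeff_sum)
  next
    case False
    then show ?thesis
      using v w by (simp add: steiner_coeffs_def)
  qed
qed

lemma quermassintegral_eqI: "steiner_coeffs K E w \<Longrightarrow> quermassintegral K E = w"
  unfolding quermassintegral_def by (blast intro: steiner_coeffs_unique)

definition support_hyperplane :: "'a::euclidean_space set \<Rightarrow> 'a set \<Rightarrow> bool" where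
  "support_hyperplane K H \<longleftrightarrow>
     (\<exists>a b. a \<noteq> 0 \<and> H = {x. a \<bullet> x = b} \<and> K \<subseteq> {x. a \<bullet> x \<le> b} \<and> K \<inter> H \<noteq> {})"

definition normal_cone :: "'a::euclidean_space set \<Rightarrow> 'a \<Rightarrow> 'a set" where
  "normal_cone K x = {u. \<forall>y\<in>K. u \<bullet> (y - x) \<le> 0}"

text \<open>
  The normal cone contains the origin, so its dimension is that of its linear span, \<^const>\<open>dim\<close>.
  The order \<open>r\<close> is an integer because 0-tangential bodies refer to (-1)-singular points,
  of which there are none.
\<close>

definition singular_point :: "int \<Rightarrow> 'a::euclidean_space set \<Rightarrow> 'a \<Rightarrow> bool" where
  "singular_point r K x \<longleftrightarrow>
     x \<in> frontier K \<and> int (dim (normal_cone K x)) \<ge> int DIM('a) - r"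

definition tangential_body :: "nat \<Rightarrow> 'a::euclidean_space set \<Rightarrow> 'a set \<Rightarrow> bool" where
  "tangential_body p K E \<longleftrightarrow>
     p < DIM('a) \<and> convex_body K \<and> convex_body E \<and> E \<subseteq> K \<and>
     (\<forall>H. support_hyperplane K H \<and> \<not> support_hyperplane E H \<longrightarrow>
          (\<forall>x \<in> K \<inter> H. singular_point (int p - 1) K x))"

end

theory Submission
  imports Defs "HOL-Computational_Algebra.Fundamental_Theorem_Algebra"
begin

text \<open>
  Let \<open>K\<close> be the convex hull of the unit ball of dimension \<open>n = 15\<close> and of a concentric disc of
  radius \<open>R > 1\<close> in a plane \<open>U\<close>. A support hyperplane of \<open>K\<close> missing the ball touches \<open>K\<close> only at a
  point of the rim of the disc, where the normal cone contains a neighbourhood of the outer normal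
  in the span of that normal and the complement of \<open>U\<close>; so \<open>K\<close> is 2-tangential.
  Since \<open>K + \<rho>B\<close> is a body of birevolution about \<open>U\<close>, its volume reduces to a one-dimensional
  integral, and up to a positive constant the Steiner polynomial is
  \<open>(1 + M) (1 + s)^15 - 15 (M - R I) s^14 - M s^15\<close> with \<open>M\<close> of order \<open>R^2\<close> and \<open>0 \<le> I \<le> 1\<close>.
  After division by \<open>M\<close> it tends to \<open>(1 + s)^15 - 15 s^14 - s^15\<close> as \<open>R\<close> tends to infinity, and this
  limit has a root near \<open>0.013 + 1.758 i\<close>. The root survives for large \<open>R\<close> by a Gauss-Lucas argument:
  if all roots of \<open>p\<close> had real part at most 0, then \<open>p'/p\<close> would have nonnegative real part on the
  right half-plane.
\<close>

section \<open>Polynomials with roots in the left half-plane\<close>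

text \<open>The logarithmic derivative \<open>p'/p\<close> is the sum of \<open>1/(w - r)\<close>
  over the roots \<open>r\<close>, and every summand has nonnegative real part. Multiplying by
  \<open>|p(w)|^2\<close> turns the quotient into \<open>p' * cnj p\<close>, which makes sense at
  roots of \<open>p\<close> as well.\<close>

lemma Re_pderiv_mult_cnj_nonneg:
  fixes p :: "complex poly"
  assumes "\<And>z. poly p z = 0 \<Longrightarrow> Re z \<le> 0" and "Re w \<ge> 0"
  shows "Re (poly (pderiv p) w * cnj (poly p w)) \<ge> 0"
  using assms(1)
proof (induction "degree p" arbitrary: p)
  case 0
  then obtain c where "p = [:c:]"
    by (metis degree_eq_zeroE)
  then show ?case
    by (simp add: pderiv_pCons)
next
  case (Suc k)
  then have "\<not> constant (poly p)"
    by (simp add: constant_degree)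
  then obtain r where r: "poly p r = 0"
    using fundamental_theorem_of_algebra by blast
  then obtain q where q: "p = [:-r, 1:] * q"
    by (auto simp: poly_eq_0_iff_dvd elim: dvdE)
  have "q \<noteq> 0"
    using Suc.hyps(2) q by auto
  then have "degree p = Suc (degree q)"
    unfolding q by (subst degree_mult_eq) auto
  then have IH: "Re (poly (pderiv q) w * cnj (poly q w)) \<ge> 0"
    using Suc.hyps(2) Suc.prems by (intro Suc.hyps(1)) (auto simp: q)
  have dp: "poly (pderiv p) w = poly q w + (w - r) * poly (pderiv q) w"
    by (simp only: q pderiv_mult poly_add poly_mult) (simp add: pderiv_pCons algebra_simps)
  \<comment> \<open>Product rule for \<open>p = (x - r) q\<close>: the split-off root contributes
    \<open>|q|^2 * cnj (w - r)\<close>, and the rest is a nonnegative multiple of the same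
    expression for \<open>q\<close>.\<close>
  have "poly (pderiv p) w * cnj (poly p w)
      = (poly q w * cnj (poly q w)) * cnj (w - r)
        + ((w - r) * cnj (w - r)) * (poly (pderiv q) w * cnj (poly q w))"
    unfolding dp by (simp add: q algebra_simps)
  also have "\<dots> = of_real ((cmod (poly q w))\<^sup>2) * cnj (w - r)
      + of_real ((cmod (w - r))\<^sup>2) * (poly (pderiv q) w * cnj (poly q w))"
    by (simp only: complex_norm_square)
  finally have "Re (poly (pderiv p) w * cnj (poly p w)) = (cmod (poly q w))\<^sup>2 * (Re w - Re r)
      + (cmod (w - r))\<^sup>2 * Re (poly (pderiv q) w * cnj (poly q w))"
    by (simp del: of_real_power)
  also have "\<dots> \<ge> 0"
    using IH Suc.prems[OF r] assms(2) by simp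
  finally show ?case .
qed

text \<open>Complex multiplication with the result supplied as numerals, so that high powers can be
  computed exactly along an addition chain.\<close>

lemma power_add_Complex:
  assumes "z ^ m = Complex a b" "z ^ n = Complex c d"
    and "k = m + n" "a * c - b * d = e" "a * d + b * c = f"
  shows "z ^ k = Complex e f"
  using assms by (simp add: power_add complex_eq_iff)

text \<open>The point lies slightly to the left of the root of the limit polynomial.\<close>

lemma Re_pderiv_limit_neg:
  fixes w :: complex
  defines "w \<equiv> Complex (1/80) (140/80)"
  shows "Re ((15 * (1 + w) ^ 14 - 210 * w ^ 13 - 15 * w ^ 14) *
   cnj ((1 + w) ^ 15 - 15 * w ^ 14 - w ^ 15)) < 0"
proof -
  \<comment> \<open>Clearing the denominator 80 leaves powers of the Gaussian integers
    \<open>1 + 140 i\<close> and \<open>81 + 140 i\<close>. The chain 1, 2, 3, 6, 7, 13, 14, 15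
    reaches all exponents that occur.\<close>
  have u1: "(Complex 1 140) ^ 1 = Complex 1 140"
    by simp
  have u2: "(Complex 1 140) ^ 2 = Complex (-19599) 280"
    by (rule power_add_Complex[OF u1 u1]) simp_all
  have u3: "(Complex 1 140) ^ 3 = Complex (-58799) (-2743580)"
    by (rule power_add_Complex[OF u2 u1]) simp_all
  have u6: "(Complex 1 140) ^ 6 = Complex (-7523773893999) 322639520840"
    by (rule power_add_Complex[OF u3 u3]) simp_all
  have u7: "(Complex 1 140) ^ 7 = Complex (-52693306811599) (-1053005705639020)"
    by (rule power_add_Complex[OF u6 u1]) simp_all
  have u13: "(Complex 1 140) ^ 13 = Complex 736193782486747738096871201 7905575895057684848524017820"
    by (rule power_add_Complex[OF u7 u6]) simp_all
  have u14: "(Complex 1 140) ^ 14 = Complex (-1106044431525589131055265623599) 110972705443202368182085985960"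
    by (rule power_add_Complex[OF u7 u7]) simp_all
  have u15: "(Complex 1 140) ^ 15 = Complex (-16642223193573920676547303657999) (-154735247708139275979555101317900)"
    by (rule power_add_Complex[OF u14 u1]) simp_all
  have v1: "(Complex 81 140) ^ 1 = Complex 81 140"
    by simp
  have v2: "(Complex 81 140) ^ 2 = Complex (-13039) 22680"
    by (rule power_add_Complex[OF v1 v1]) simp_all
  have v3: "(Complex 81 140) ^ 3 = Complex (-4231359) 11620"
    by (rule power_add_Complex[OF v2 v1]) simp_all
  have v6: "(Complex 81 140) ^ 6 = Complex 17904263962481 (-98336783160)"
    by (rule power_add_Complex[OF v3 v3]) simp_all
  have v7: "(Complex 81 140) ^ 7 = Complex 1464012530603361 2498631675311380"
    by (rule power_add_Complex[OF v6 v1]) simp_all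
  have v13: "(Complex 81 140) ^ 13 = Complex 26457774193554171196136859441 44592194777025602323688133020"
    by (rule power_add_Complex[OF v7 v6]) simp_all
  have v14: "(Complex 81 140) ^ 14 = Complex (-4099827559105696458429253008079) 7316056164036657755677899096360"
    by (rule power_add_Complex[OF v7 v7]) simp_all
  have v15: "(Complex 81 140) ^ 15 = Complex (-1356333895252693498927675367144799) 18624691012171774029814405674100"
    by (rule power_add_Complex[OF v14 v1]) simp_all
  have w: "w = Complex 1 140 / 80" "1 + w = Complex 81 140 / 80"
    by (simp_all add: w_def complex_eq_iff)
  show ?thesis
    unfolding w(2) unfolding w(1) power_divide u13 u14 u15 v14 v15 by (simp add: complex_eq_iff)
qed

section \<open>The convex hull of a ball and a disc\<close>

text \<open>Both sets are convex and nonempty, so the hull is the union of the segments joining a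
  point of one to a point of the other. The weight \<open>l\<close> of the disc point is the
  parameter on which the description of the Minkowski sum rests.\<close>

lemma convex_hull_ball_disc:
  fixes U :: "'a::euclidean_space set"
  assumes "subspace U" "R \<ge> 0"
  shows "convex hull (cball 0 1 \<union> (U \<inter> cball 0 R)) =
    {(1 - l) *\<^sub>R b + l *\<^sub>R d | l b d. 0 \<le> l \<and> l \<le> 1 \<and> norm b \<le> 1 \<and> d \<in> U \<and> norm d \<le> R}"
proof -
  have "convex (U \<inter> cball 0 R)" "0 \<in> U \<inter> cball 0 R"
    using assms by (auto intro: convex_Int subspace_imp_convex subspace_0)
  then have "convex hull (cball 0 1 \<union> (U \<inter> cball 0 R)) =
      {u *\<^sub>R b + l *\<^sub>R d | u l b d. u \<ge> 0 \<and> l \<ge> 0 \<and> u + l = 1 \<and> b \<in> cball 0 1 \<and> d \<in> U \<inter> cball 0 R}"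
    by (intro convex_hull_union_two) auto
  also have "\<dots> = {(1 - l) *\<^sub>R b + l *\<^sub>R d | l b d. 0 \<le> l \<and> l \<le> 1 \<and> norm b \<le> 1 \<and> d \<in> U \<and> norm d \<le> R}"
    (is "?A = ?B")
  proof (intro subset_antisym subsetI)
    fix x assume "x \<in> ?A"
    then obtain u l b d where x: "x = u *\<^sub>R b + l *\<^sub>R d" "u \<ge> 0" "l \<ge> 0" "u + l = 1"
        "norm b \<le> 1" "d \<in> U" "norm d \<le> R"
      by auto
    moreover from x have "u = 1 - l"
      by simp
    ultimately show "x \<in> ?B"
      by auto
  next
    fix x assume "x \<in> ?B"
    then obtain l b d where x: "x = (1 - l) *\<^sub>R b + l *\<^sub>R d" "0 \<le> l" "l \<le> 1"
        "norm b \<le> 1" "d \<in> U" "norm d \<le> R"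
      by auto
    then show "x \<in> ?A"
      by (intro CollectI exI[of _ "1 - l"] exI[of _ l] exI[of _ b] exI[of _ d]) auto
  qed
  finally show ?thesis .
qed

lemma convex_body_hull_ball_disc:
  fixes U :: "'a::euclidean_space set"
  assumes "subspace U"
  shows "convex_body (convex hull (cball 0 1 \<union> (U \<inter> cball 0 R)))"
  unfolding convex_body_def using assms
  by (auto intro!: compact_convex_hull compact_Un closed_Int_compact closed_subspace)

section \<open>Normal cones on the rim and tangentiality\<close>

text \<open>For small \<open>z\<close> orthogonal to \<open>U\<close>, the vector
  \<open>d + z\<close> is an outer normal at \<open>d\<close>. These vectors span \<open>d\<close>
  together with the orthogonal complement of \<open>U\<close>; the extra direction \<open>d\<close>
  makes the inequality strict.\<close>

lemma dim_normal_cone_hull_ball_disc: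
  fixes U :: "'a::euclidean_space set"
  assumes "subspace U" "R > 1" "d \<in> U" "norm d = R"
  shows "dim (normal_cone (convex hull (cball 0 1 \<union> (U \<inter> cball 0 R))) d) > DIM('a) - dim U"
proof -
  let ?K = "convex hull (cball 0 1 \<union> (U \<inter> cball 0 R))"
  let ?V = "{y \<in> UNIV. \<forall>x\<in>U. orthogonal x y}"
  have V: "dim ?V + dim U = DIM('a)"
    using dim_subspace_orthogonal_to_vectors[OF assms(1) subspace_UNIV] by simp
  have "subspace ?V"
    by (simp add: subspace_orthogonal_to_vectors)
  have dd: "d \<bullet> d = R\<^sup>2"
    using assms(4) by (simp add: dot_square_norm)
  have R2: "R\<^sup>2 < R ^ 4"
    using assms(2) by simp
  \<comment> \<open>The functional \<open>d + z\<close> has the value \<open>R^2\<close> at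
    \<open>d\<close>. On the disc \<open>z\<close> vanishes, and on the ball the functional is at
    most \<open>norm (d + z)\<close>; the bound on \<open>z\<close> says precisely that this norm is
    at most \<open>R^2\<close>.\<close>
  have cone: "d + z \<in> normal_cone ?K d" if z: "z \<in> ?V" "(norm z)\<^sup>2 \<le> R ^ 4 - R\<^sup>2" for z
  proof -
    have dz: "d \<bullet> z = 0"
      using z assms(3) by (auto simp: orthogonal_def)
    have "(norm (d + z))\<^sup>2 = R\<^sup>2 + (norm z)\<^sup>2"
      using dz dd by (simp add: power2_norm_eq_inner inner_add inner_commute)
    also have "\<dots> \<le> (R\<^sup>2)\<^sup>2"
      using z by simp
    finally have n: "norm (d + z) \<le> R\<^sup>2"
      by (rule power2_le_imp_le) simp
    have "?K \<subseteq> {y. (d + z) \<bullet> y \<le> R\<^sup>2}"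
    proof (rule hull_minimal)
      show "cball 0 1 \<union> U \<inter> cball 0 R \<subseteq> {y. (d + z) \<bullet> y \<le> R\<^sup>2}"
      proof
        fix y assume y: "y \<in> cball 0 1 \<union> U \<inter> cball 0 R"
        then consider "norm y \<le> 1" | "y \<in> U" "norm y \<le> R"
          by auto
        then show "y \<in> {y. (d + z) \<bullet> y \<le> R\<^sup>2}"
        proof cases
          case 1
          have "(d + z) \<bullet> y \<le> norm (d + z) * norm y"
            by (rule norm_cauchy_schwarz)
          also have "\<dots> \<le> R\<^sup>2 * 1"
            using n 1 by (intro mult_mono) auto
          finally show ?thesis by simp
        next
          case 2
          then have "z \<bullet> y = 0"
            using z by (auto simp: orthogonal_def inner_commute)
          moreover have "d \<bullet> y \<le> norm d * norm y"
            by (rule norm_cauchy_schwarz)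
          moreover have "norm d * norm y \<le> R * R"
            using 2 assms by (intro mult_mono) auto
          ultimately show ?thesis
            by (simp add: inner_add_left power2_eq_square)
        qed
      qed
    qed (rule convex_halfspace_le)
    moreover have "(d + z) \<bullet> d = R\<^sup>2"
      using dd dz by (simp add: inner_add_left inner_commute[of z])
    ultimately show ?thesis
      by (auto simp: normal_cone_def inner_diff_right)
  qed
  let ?N = "normal_cone ?K d"
  have d: "d \<in> span ?N"
    using cone[of 0] R2 by (auto simp: orthogonal_def intro: span_base)
  have "z \<in> span ?N" if z: "z \<in> ?V" for z
  proof (cases "z = 0")
    case False
    \<comment> \<open>\<open>z\<close> is rescaled to the largest length that \<open>cone\<close>
      admits; subtracting \<open>d\<close> then leaves a multiple of \<open>z\<close> in the
      span.\<close>
    define c where "c = sqrt (R ^ 4 - R\<^sup>2) / norm z"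
    have c: "c > 0"
      using False R2 by (simp add: c_def)
    have "(norm (c *\<^sub>R z))\<^sup>2 = R ^ 4 - R\<^sup>2"
      using False R2 by (simp add: c_def)
    moreover have "c *\<^sub>R z \<in> ?V"
      using \<open>subspace ?V\<close> z by (rule subspace_scale)
    ultimately have "d + c *\<^sub>R z \<in> span ?N"
      by (intro span_base cone) auto
    then have "c *\<^sub>R z \<in> span ?N"
      using d span_add_eq by blast
    then show ?thesis
      using c by (metis less_irrefl span_mul scaleR_scaleR left_inverse scaleR_one)
  qed (simp add: span_zero)
  with d have "dim (insert d ?V) \<le> dim ?N"
    by (intro dim_mono) auto
  moreover have "d \<notin> span ?V"
  proof -
    have "span ?V = ?V"
      using \<open>subspace ?V\<close> by (rule real_vector.span_eq_iff[THEN iffD2])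
    moreover have "d \<notin> ?V"
      proof
      assume "d \<in> ?V"
      then have "orthogonal d d"
        using assms(3) by blast
      with assms show False
        by (auto simp: orthogonal_self)
    qed
    ultimately show ?thesis
      by metis
  qed
  ultimately show ?thesis
    using V by (simp add: dim_insert)
qed

text \<open>A support hyperplane of the hull that misses the ball can touch only where all the
  weight is on the disc, and there only on the rim, where the bound on the normal cone
  applies.\<close>

lemma tangential_body_hull_ball_disc:
  fixes U :: "'a::euclidean_space set"
  assumes "subspace U" "dim U < DIM('a)" "R > 1"
  shows "tangential_body (dim U) (convex hull (cball 0 1 \<union> (U \<inter> cball 0 R))) (cball 0 1)"
    (is "tangential_body _ ?K _")
  unfolding tangential_body_def
proof (intro conjI allI impI ballI)
  show "convex_body ?K"
    using assms convex_body_hull_ball_disc by blast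
  show "convex_body (cball 0 1 :: 'a set)"
    by (simp add: convex_body_def)
  show sub: "cball 0 1 \<subseteq> ?K"
    by (meson hull_subset le_supE)
  fix H x
  assume H: "support_hyperplane ?K H \<and> \<not> support_hyperplane (cball 0 1) H" and x: "x \<in> ?K \<inter> H"
  then obtain a b where ab: "a \<noteq> 0" "H = {x. a \<bullet> x = b}" "?K \<subseteq> {x. a \<bullet> x \<le> b}"
    by (auto simp: support_hyperplane_def)
  \<comment> \<open>The functional \<open>a\<close> is maximal over the ball at
    \<open>a/|a|\<close>, so \<open>norm a\<close> is the support value of the ball.\<close>
  have tip: "a /\<^sub>R norm a \<in> cball 0 1" "a \<bullet> (a /\<^sub>R norm a) = norm a"
    using ab by (auto simp: dot_square_norm power2_eq_square)
  have ba: "norm a < b"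
  proof (rule ccontr)
    assume "\<not> norm a < b"
    moreover have "norm a \<le> b"
      using tip(2) subsetD[OF ab(3) subsetD[OF sub tip(1)]] by simp
    ultimately have b: "b = norm a" by simp
    have "support_hyperplane (cball 0 1) H"
      unfolding support_hyperplane_def
    proof (intro exI conjI)
      have "a /\<^sub>R norm a \<in> cball 0 1 \<inter> H"
        using tip ab(2) b by simp
      then show "cball 0 1 \<inter> H \<noteq> {}"
        by blast
    qed (use ab sub in auto)
    with H show False by simp
  qed
  obtain l e d where led: "x = (1 - l) *\<^sub>R e + l *\<^sub>R d" "0 \<le> l" "l \<le> 1" "norm e \<le> 1" "d \<in> U" "norm d \<le> R"
    using x convex_hull_ball_disc[OF assms(1), of R] assms(3) by auto
  have "d \<in> ?K"
    using led by (intro hull_inc) auto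
  then have adb: "a \<bullet> d \<le> b"
    using ab by auto
  have ae: "a \<bullet> e \<le> norm a"
    using norm_cauchy_schwarz[of a e] led by (metis mult_left_le norm_ge_zero order_trans)
  \<comment> \<open>The ball end of the segment stays strictly below \<open>b\<close>, so attaining
    \<open>b\<close> forces full weight on the disc end.\<close>
  have "b = (1 - l) * (a \<bullet> e) + l * (a \<bullet> d)"
    using x ab led by (auto simp: inner_add_right)
  also have "\<dots> \<le> (1 - l) * norm a + l * b"
    using ae adb led by (intro add_mono mult_left_mono) auto
  finally have "(1 - l) * (b - norm a) \<le> 0"
    by (simp add: algebra_simps)
  then have "l = 1"
    using ba led by (auto simp: mult_le_0_iff)
  then have xd: "x = d"
    using led by simp
  then have adb: "a \<bullet> d = b"
    using x ab by auto
  have "b > 0"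
    using ba by (meson norm_ge_zero le_less_trans)
  have "norm d = R"
  proof (rule ccontr)
    assume "norm d \<noteq> R"
    then have d: "norm d < R" "norm d > 0"
      using led adb \<open>b > 0\<close> by auto
    \<comment> \<open>Stretching \<open>d\<close> to the rim stays in the hull but would push
      \<open>a\<close> beyond \<open>b\<close>.\<close>
    have "(R / norm d) *\<^sub>R d \<in> ?K"
      using led d assms by (intro hull_inc) (auto intro: subspace_scale)
    then have "R / norm d * b \<le> b"
      using ab adb by auto
    then show False
      using d \<open>b > 0\<close> by (simp add: field_simps)
  qed
  then have "dim (normal_cone ?K x) > DIM('a) - dim U"
    unfolding xd by (rule dim_normal_cone_hull_ball_disc[OF assms(1,3) led(5)])
  moreover have "x \<in> frontier ?K"
  proof -
    have "x \<notin> interior {x. a \<bullet> x \<le> b}"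
      using ab adb xd by simp
    then have "x \<notin> interior ?K"
      using interior_mono[OF ab(3)] by blast
    then show ?thesis
      using x closure_subset[of ?K] by (auto simp: frontier_def)
  qed
  \<comment> \<open>Order \<open>dim U - 1\<close> asks for dimension at least
    \<open>DIM('a) - dim U + 1\<close>, which is what the strict inequality gives.\<close>
  ultimately show "singular_point (int (dim U) - 1) ?K x"
    using assms unfolding singular_point_def by linarith
qed (use assms in auto)

text \<open>
  In the coordinates \<open>(\<bar>x\<bar>, \<bar>y\<bar>)\<close> along and across \<open>U\<close>, the boundary of \<open>K + \<rho>B\<close> consists of an arc of
  radius \<open>1 + \<rho>\<close> about the origin, a common tangent segment, and an arc of radius \<open>\<rho>\<close> about \<open>(R, 0)\<close>.
\<close>

definition profile :: "real \<Rightarrow> real \<Rightarrow> real \<Rightarrow> real" where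
  "profile R \<rho> r =
     (if r \<le> (1 + \<rho>) / R then sqrt ((1 + \<rho>)\<^sup>2 - r\<^sup>2)
      else if r \<le> R + \<rho> / R then (1 + \<rho> - r / R) / sqrt (1 - 1 / R\<^sup>2)
      else sqrt (\<rho>\<^sup>2 - (r - R)\<^sup>2))"

section \<open>The Minkowski sum in meridian coordinates\<close>

text \<open>With disc weight \<open>l\<close>, a point of the sum lies within
  \<open>1 + \<rho> - l\<close> of a point of \<open>U\<close> of norm at most \<open>l R\<close>;
  \<open>p\<close> and \<open>t\<close> are the lengths of the difference along and across
  \<open>U\<close>. \<open>profile\<close> is the upper envelope of these discs:
  \<open>l = 0\<close> governs the first arc, \<open>l = 1\<close> the last, and the common tangent
  the part between.\<close>

lemma le_profileI:
  assumes "R > 1" "\<rho> \<ge> 0" "r \<ge> 0" "t \<ge> 0" "0 \<le> l" "l \<le> 1" "p \<ge> 0"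
    and rp: "r \<le> l * R + p" and pt: "p\<^sup>2 + t\<^sup>2 \<le> (1 + \<rho> - l)\<^sup>2"
  shows "r \<le> R + \<rho> \<and> t \<le> profile R \<rho> r"
proof
  define S where "S = sqrt (1 - 1 / R\<^sup>2)"
  have R2: "R\<^sup>2 > 1"
    using assms(1) by simp
  then have "1 / R\<^sup>2 < 1"
    by (subst divide_less_eq_1_pos) linarith+
  then have S2: "S\<^sup>2 = 1 - 1 / R\<^sup>2" and S: "S > 0"
    by (simp_all add: S_def)
  have "p\<^sup>2 \<le> (1 + \<rho> - l)\<^sup>2"
    using pt zero_le_power2[of t] by linarith
  then have p: "p \<le> 1 + \<rho> - l"
    by (rule power2_le_imp_le) (use assms in auto)
  have "l * (R - 1) \<le> R - 1"
    using assms by (simp add: mult_left_le_one_le)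
  then show "r \<le> R + \<rho>"
    using rp p by (simp add: algebra_simps)
  have sq: "(r - l * R)\<^sup>2 \<le> p\<^sup>2" if "r \<ge> l * R"
    using that rp by (intro power_mono) auto
  consider "r \<le> (1 + \<rho>) / R" | "r > (1 + \<rho>) / R" "r \<le> R + \<rho> / R" | "r > (1 + \<rho>) / R" "r > R + \<rho> / R"
    by linarith
  then show "t \<le> profile R \<rho> r"
  proof cases
    case 1
    then have rR: "r * R \<le> 1 + \<rho>"
      using assms(1) by (simp add: field_simps)
    have "t\<^sup>2 \<le> (1 + \<rho>)\<^sup>2 - r\<^sup>2"
    proof (cases "r \<ge> l * R")
      case True
      \<comment> \<open>The gap to be shown nonnegative is
        \<open>2 l (1 + \<rho> - r R) + l^2 (R^2 - 1)\<close>.\<close>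
      have "l * (r * R) \<le> l * (1 + \<rho>)"
        using rR assms by (intro mult_left_mono) auto
      moreover have "l\<^sup>2 * 1 \<le> l\<^sup>2 * R\<^sup>2"
        using R2 by (intro mult_left_mono) auto
      ultimately show ?thesis
        using sq[OF True] pt by (simp add: power2_eq_square algebra_simps)
    next
      case False
      \<comment> \<open>Left of the centre only the radius \<open>1 + \<rho> - l\<close> is used,
        and it is at most \<open>1 + \<rho> - r / R\<close>.\<close>
      have "r / R \<le> l"
        using False assms(1) by (simp add: field_simps)
      then have "(1 + \<rho> - l)\<^sup>2 \<le> (1 + \<rho> - r / R)\<^sup>2"
        using assms by (intro power_mono) auto
      also have "\<dots> = (1 + \<rho>)\<^sup>2 - 2 * ((1 + \<rho>) * (r / R)) + (r / R)\<^sup>2"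
        by (simp add: power2_eq_square algebra_simps)
      also have "\<dots> \<le> (1 + \<rho>)\<^sup>2 - r\<^sup>2"
      proof -
        have "r * (r * R) \<le> r * (1 + \<rho>)"
          using rR assms by (intro mult_left_mono) auto
        then have "r\<^sup>2 \<le> (1 + \<rho>) * (r / R)"
          using assms(1) by (simp add: field_simps power2_eq_square)
        moreover have "(r / R)\<^sup>2 \<le> r\<^sup>2"
          using assms mult_left_mono[of 1 R r] by (intro power_mono) (auto simp: divide_le_eq)
        ultimately show ?thesis by linarith
      qed
      finally show ?thesis
        using pt zero_le_power2[of p] by linarith
    qed
    then show ?thesis
      using 1 by (simp add: profile_def real_le_rsqrt)
  next
    case 2
    \<comment> \<open>The tangent line has unit normal \<open>(1/R, S)\<close>; this is
      Cauchy-Schwarz, proved through the Lagrange identity.\<close>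
    have "p / R + t * S \<le> 1 + \<rho> - l"
    proof (rule power2_le_imp_le)
      have "(p\<^sup>2 + t\<^sup>2) * ((1 / R)\<^sup>2 + S\<^sup>2) = p\<^sup>2 + t\<^sup>2"
        using S2 by (simp add: power_divide)
      moreover have "(p\<^sup>2 + t\<^sup>2) * ((1 / R)\<^sup>2 + S\<^sup>2) - (p / R + t * S)\<^sup>2 = (p * S - t / R)\<^sup>2"
        by (simp add: power2_eq_square algebra_simps)
      ultimately show "(p / R + t * S)\<^sup>2 \<le> (1 + \<rho> - l)\<^sup>2"
        using pt zero_le_power2[of "p * S - t / R"] by linarith
    qed (use assms in auto)
    moreover have "r / R \<le> l + p / R"
      using rp assms(1) by (simp add: field_simps)
    ultimately have "t * S \<le> 1 + \<rho> - r / R"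
      by linarith
    then show ?thesis
      using 2 S by (simp add: profile_def S_def[symmetric] field_simps)
  next
    case 3
    have "l * R \<le> R"
      using assms by (simp add: mult_left_le_one_le)
    moreover have "R < r"
      using 3 assms by (smt (verit) divide_nonneg_pos)
    ultimately have "r \<ge> l * R" by simp
    have "\<rho> \<le> R * (r - R)"
      using 3 assms(1) by (simp add: field_simps)
    then have "0 \<le> (1 - l) * (R * (r - R) - \<rho>)"
      using assms by simp
    moreover have "0 \<le> (1 - l)\<^sup>2 * (R\<^sup>2 - 1)"
      using R2 by simp
    \<comment> \<open>Comparison with the disc \<open>l = 1\<close>: expanding in
      \<open>1 - l\<close> leaves just the two nonnegative terms above.\<close>
    moreover have "\<rho>\<^sup>2 - (r - R)\<^sup>2 =
        (1 + \<rho> - l)\<^sup>2 - (r - l * R)\<^sup>2 + 2 * ((1 - l) * (R * (r - R) - \<rho>)) + (1 - l)\<^sup>2 * (R\<^sup>2 - 1)"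
      by (simp add: power2_eq_square algebra_simps)
    moreover have "t\<^sup>2 \<le> (1 + \<rho> - l)\<^sup>2 - (r - l * R)\<^sup>2"
      using sq[OF \<open>r \<ge> l * R\<close>] pt by linarith
    ultimately have "t\<^sup>2 \<le> \<rho>\<^sup>2 - (r - R)\<^sup>2"
      by linarith
    then show ?thesis
      using 3 by (simp add: profile_def real_le_rsqrt)
  qed
qed

text \<open>Each arc names its disc: \<open>l = 0\<close> with \<open>p = r\<close>, or
  \<open>l = 1\<close> with \<open>p = r - R\<close>. On the tangent segment an intermediate disc is
  chosen.\<close>

lemma le_profileE:
  assumes "R > 1" "\<rho> \<ge> 0" "r \<ge> 0" "t \<ge> 0" "r \<le> R + \<rho>" "t \<le> profile R \<rho> r"
  obtains l p where "0 \<le> l" "l \<le> 1" "0 \<le> p" "p \<le> r" "r - p \<le> l * R" "p\<^sup>2 + t\<^sup>2 \<le> (1 + \<rho> - l)\<^sup>2"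
proof -
  define S where "S = sqrt (1 - 1 / R\<^sup>2)"
  have R2: "R\<^sup>2 > 1"
    using assms(1) by simp
  then have "1 / R\<^sup>2 < 1"
    by (subst divide_less_eq_1_pos) linarith+
  then have S2: "S\<^sup>2 = 1 - 1 / R\<^sup>2" and S: "S > 0"
    by (simp_all add: S_def)
  consider "r \<le> (1 + \<rho>) / R" | "r > (1 + \<rho>) / R" "r \<le> R + \<rho> / R" | "r > (1 + \<rho>) / R" "r > R + \<rho> / R"
    by linarith
  then show thesis
  proof cases
    case 1
    then have "t \<le> sqrt ((1 + \<rho>)\<^sup>2 - r\<^sup>2)"
      using assms by (simp add: profile_def)
    moreover have "r \<le> 1 + \<rho>"
      using 1 assms by (smt (verit) divide_le_eq_1_pos mult_left_le frac_le div_by_1)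
    ultimately have "t\<^sup>2 \<le> (1 + \<rho>)\<^sup>2 - r\<^sup>2"
      using assms by (metis abs_of_nonneg diff_ge_0_iff_ge power_mono real_sqrt_ge_0_iff real_sqrt_pow2)
    then show ?thesis
      using assms by (intro that[of 0 r]) auto
  next
    case 2
    define e where "e = 1 + \<rho> - r / R"
    have "profile R \<rho> r = e / S"
      using 2 by (simp add: profile_def S_def e_def)
    then have te: "t * S \<le> e"
      using assms S by (simp add: pos_le_divide_eq)
    \<comment> \<open>The disc of weight \<open>l\<close> touches the tangent line at radial
      coordinate \<open>l R + (1 + \<rho> - l)/R\<close>; equating this with \<open>r\<close> gives
      \<open>l\<close>.\<close>
    define l where "l = (R * r - (1 + \<rho>)) / (R\<^sup>2 - 1)"
    have e0: "e \<ge> 0"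
      using te S assms by (meson less_eq_real_def mult_nonneg_nonneg order_trans)
    have l0: "0 \<le> l"
      using 2 assms R2 by (simp add: l_def field_simps)
    have l1: "l \<le> 1"
      using 2 assms R2 by (simp add: l_def divide_le_eq_1 field_simps power2_eq_square)
    have S2': "S\<^sup>2 = (R\<^sup>2 - 1) / R\<^sup>2"
      using S2 R2 assms(1) by (simp add: field_simps)
    have le: "1 + \<rho> - l = e / S\<^sup>2"
      unfolding S2' l_def e_def using R2 assms(1) by (simp add: field_simps power2_eq_square)
    have pe: "r - l * R = e / (R * S\<^sup>2)"
      unfolding S2' l_def e_def using R2 assms(1) by (simp add: field_simps power2_eq_square)
    have "t \<le> e / S"
      using te S by (simp add: field_simps)
    then have "t\<^sup>2 \<le> (e / S)\<^sup>2"
      using assms by (intro power_mono) auto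
    then have "(r - l * R)\<^sup>2 + t\<^sup>2 \<le> (e / (R * S\<^sup>2))\<^sup>2 + (e / S)\<^sup>2"
      by (simp add: pe)
    also have "\<dots> = e\<^sup>2 / (S\<^sup>2)\<^sup>2 * (1 / R\<^sup>2 + S\<^sup>2)"
      using S assms(1) by (simp add: field_simps power2_eq_square)
    also have "\<dots> = (1 + \<rho> - l)\<^sup>2"
      unfolding le using S2 by (simp add: power_divide)
    finally have "(r - l * R)\<^sup>2 + t\<^sup>2 \<le> (1 + \<rho> - l)\<^sup>2" .
    moreover have "0 \<le> r - l * R"
      unfolding pe using e0 S assms by simp
    moreover have "0 \<le> l * R"
      using l0 assms by simp
    ultimately show ?thesis
      using l0 l1 by (intro that[of l "r - l * R"]) auto
  next
    case 3
    have "t \<le> sqrt (\<rho>\<^sup>2 - (r - R)\<^sup>2)"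
      using 3 assms by (simp add: profile_def not_le)
    moreover have Rr: "R < r"
      using 3 assms by (smt (verit) divide_nonneg_pos)
    moreover have "(r - R)\<^sup>2 \<le> \<rho>\<^sup>2"
      using Rr assms by (intro power_mono) auto
    ultimately have "t\<^sup>2 \<le> \<rho>\<^sup>2 - (r - R)\<^sup>2"
      using assms by (metis abs_of_nonneg diff_ge_0_iff_ge power_mono real_sqrt_ge_0_iff real_sqrt_pow2)
    then show ?thesis
      using assms Rr by (intro that[of 1 "r - R"]) auto
  qed
qed

text \<open>By Pythagoras and the triangle inequality, membership depends only on the two norms,
  which reduces it to the planar statements about \<open>profile\<close>.\<close>

lemma mem_hull_ball_disc_plus_cball_iff:
  fixes U :: "'a::euclidean_space set"
  assumes U: "subspace U" and "x \<in> U" and yU: "\<And>u. u \<in> U \<Longrightarrow> orthogonal u y" and "R > 1" "\<rho> \<ge> 0"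
  shows "x + y \<in> convex hull (cball 0 1 \<union> (U \<inter> cball 0 R)) + (\<lambda>y. \<rho> *\<^sub>R y) ` cball 0 1
     \<longleftrightarrow> norm x \<le> R + \<rho> \<and> norm y \<le> profile R \<rho> (norm x)" (is "?L \<longleftrightarrow> ?R")
proof
  assume ?L
  then obtain k e' where k: "k \<in> convex hull (cball 0 1 \<union> (U \<inter> cball 0 R))" "norm e' \<le> 1"
    and xy: "x + y = k + \<rho> *\<^sub>R e'"
    by (auto simp: set_plus_def)
  then obtain l e d where led: "k = (1 - l) *\<^sub>R e + l *\<^sub>R d" "0 \<le> l" "l \<le> 1" "norm e \<le> 1" "d \<in> U" "norm d \<le> R"
    using convex_hull_ball_disc[OF U, of R] assms by auto
  have xd: "x - l *\<^sub>R d \<in> U"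
    using U led assms by (simp add: subspace_diff subspace_scale)
  have "(x - l *\<^sub>R d) + y = (x + y) - l *\<^sub>R d"
    by simp
  also have "\<dots> = (1 - l) *\<^sub>R e + \<rho> *\<^sub>R e'"
    unfolding xy led(1) by simp
  finally have "norm ((x - l *\<^sub>R d) + y) = norm ((1 - l) *\<^sub>R e + \<rho> *\<^sub>R e')"
    by (rule arg_cong)
  also have "\<dots> \<le> (1 - l) * norm e + \<rho> * norm e'"
    using led assms by (intro order_trans[OF norm_triangle_ineq]) auto
  also have "\<dots> \<le> (1 - l) * 1 + \<rho> * 1"
    using led k assms by (intro add_mono mult_left_mono) auto
  finally have "(norm ((x - l *\<^sub>R d) + y))\<^sup>2 \<le> (1 + \<rho> - l)\<^sup>2"
    by (intro power_mono) auto
  then have "(norm (x - l *\<^sub>R d))\<^sup>2 + (norm y)\<^sup>2 \<le> (1 + \<rho> - l)\<^sup>2"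
    using norm_add_Pythagorean[OF yU[OF xd]] by simp
  moreover have "norm x \<le> norm (l *\<^sub>R d) + norm (x - l *\<^sub>R d)"
    by (metis norm_triangle_sub)
  then have "norm x \<le> l * R + norm (x - l *\<^sub>R d)"
    using mult_left_mono[OF led(6,2)] led(2) by simp
  ultimately show ?R
    using led assms by (intro le_profileI[of R \<rho> _ _ l "norm (x - l *\<^sub>R d)"]) auto
next
  assume ?R
  then obtain l p where l: "0 \<le> l" "l \<le> 1" "0 \<le> p" "p \<le> norm x" "norm x - p \<le> l * R"
     "p\<^sup>2 + (norm y)\<^sup>2 \<le> (1 + \<rho> - l)\<^sup>2"
    using le_profileE[of R \<rho> "norm x" "norm y"] assms by auto
  \<comment> \<open>\<open>l d\<close> is to be the part of \<open>x\<close> of length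
    \<open>norm x - p\<close>. If \<open>l = 0\<close> or \<open>x = 0\<close>, division by zero
    gives \<open>d = 0\<close>, as required.\<close>
  define d where "d = ((norm x - p) / (l * norm x)) *\<^sub>R x"
  have dU: "d \<in> U"
    using U assms by (simp add: d_def subspace_scale)
  have dR: "norm d \<le> R"
    using l assms by (auto simp: d_def divide_simps mult.commute)
  have ld: "x - l *\<^sub>R d = (p / norm x) *\<^sub>R x"
  proof (cases "l = 0 \<or> x = 0")
    case True
    then show ?thesis
      using l by (auto simp: d_def)
  next
    case False
    then have "l *\<^sub>R d = (1 - p / norm x) *\<^sub>R x"
      by (simp add: d_def divide_simps)
    then show ?thesis
      by (simp add: algebra_simps)
  qed
  then have nld: "norm (x - l *\<^sub>R d) \<le> p"
    using l by auto
  have xd: "x - l *\<^sub>R d \<in> U"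
    using U dU assms by (simp add: subspace_diff subspace_scale)
  define z where "z = (x - l *\<^sub>R d) + y"
  have "(norm z)\<^sup>2 = (norm (x - l *\<^sub>R d))\<^sup>2 + (norm y)\<^sup>2"
    unfolding z_def using yU[OF xd] by (rule norm_add_Pythagorean)
  also have "\<dots> \<le> p\<^sup>2 + (norm y)\<^sup>2"
    using nld by (intro add_mono power_mono) auto
  finally have z: "norm z \<le> 1 + \<rho> - l"
    using l assms by (intro power2_le_imp_le[of "norm z" "1 + \<rho> - l"]) linarith+
  \<comment> \<open>One vector \<open>e\<close> serves both as the ball point of the hull and as the
    point of the added ball, since the weights \<open>1 - l\<close> and \<open>\<rho>\<close> add
    up. If the total weight vanishes, \<open>z = 0\<close> and \<open>e = 0\<close>.\<close>
  define e where "e = z /\<^sub>R (1 + \<rho> - l)"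
  have e: "norm e \<le> 1" "(1 + \<rho> - l) *\<^sub>R e = z"
    using z l assms by (auto simp: e_def divide_simps)
  have "x + y = ((1 - l) *\<^sub>R e + l *\<^sub>R d) + \<rho> *\<^sub>R e"
    using e(2) by (simp add: z_def algebra_simps)
  moreover have "(1 - l) *\<^sub>R e + l *\<^sub>R d \<in> convex hull (cball 0 1 \<union> (U \<inter> cball 0 R))"
    using convex_hull_ball_disc[OF U, of R] assms l e(1) dU dR by auto
  ultimately show ?L
    using e(1) by (metis imageI mem_cball_0 set_plus_intro)
qed

section \<open>Volumes of bodies of birevolution\<close>

text \<open>A bijection of the standard bases induces an isometry under which preimages of boxes are
  boxes of equal volume, and boxes determine Lebesgue measure. A product space, where Fubini
  applies, can thus stand in for the ambient space.\<close>

lemma lborel_isometry_exists: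
  assumes "DIM('a) = DIM('b)"
  obtains T :: "'a::euclidean_space \<Rightarrow> 'b::euclidean_space"
    where "linear T" "\<And>x y. T x \<bullet> T y = x \<bullet> y" "distr lborel borel T = lborel"
proof -
  obtain \<phi> where \<phi>: "bij_betw \<phi> (Basis :: 'a set) (Basis :: 'b set)"
    using finite_same_card_bij[OF finite_Basis finite_Basis assms] by auto
  have \<phi>B: "\<phi> b \<in> Basis" if "b \<in> Basis" for b
    using \<phi> that by (auto simp: bij_betw_def)
  define T where "T x = (\<Sum>b\<in>Basis. (x \<bullet> b) *\<^sub>R \<phi> b)" for x
  have T_inner: "T x \<bullet> \<phi> c = x \<bullet> c" if "c \<in> Basis" for x c
  proof -
    have "T x \<bullet> \<phi> c = (\<Sum>b\<in>Basis. (x \<bullet> b) * (if b = c then 1 else 0))"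
      unfolding T_def inner_sum_left
      using \<phi> that by (intro sum.cong) (auto simp: inner_Basis \<phi>B bij_betw_def inj_on_eq_iff)
    also have "\<dots> = x \<bullet> c"
      using that by (simp add: if_distrib cong: if_cong)
    finally show ?thesis .
  qed
  have lin: "linear T"
    unfolding T_def by (intro linearI) (simp_all add: inner_add_left scaleR_left_distrib sum.distrib scaleR_sum_right)
  have inn: "T x \<bullet> T y = x \<bullet> y" for x y
  proof -
    have "T x \<bullet> T y = (\<Sum>b\<in>Basis. (y \<bullet> b) * (T x \<bullet> \<phi> b))"
      by (subst (2) T_def) (simp add: inner_sum_right)
    also have "\<dots> = (\<Sum>b\<in>Basis. (x \<bullet> b) * (y \<bullet> b))"
      by (intro sum.cong) (auto simp: T_inner)
    finally show ?thesis
      by (simp add: euclidean_inner[of x y])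
  qed
  have [measurable]: "T \<in> borel_measurable borel"
    using lin by (intro borel_measurable_continuous_onI linear_continuous_on) (simp add: linear_conv_bounded_linear)
  have "lborel = distr lborel borel T"
  proof (rule lborel_eqI)
    fix l u :: 'b
    assume lu: "\<And>b. b \<in> Basis \<Longrightarrow> l \<bullet> b \<le> u \<bullet> b"
    define p where "p v = (\<Sum>b\<in>Basis. (v \<bullet> \<phi> b) *\<^sub>R b)" for v :: 'b
    have p: "p v \<bullet> b = v \<bullet> \<phi> b" if "b \<in> Basis" for v b
      using that by (simp add: p_def inner_sum_left_Basis)
    have "T -` box l u = box (p l) (p u)"
    proof -
      have "T x \<in> box l u \<longleftrightarrow> (\<forall>c\<in>\<phi> ` Basis. l \<bullet> c < T x \<bullet> c \<and> T x \<bullet> c < u \<bullet> c)" for x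
        using \<phi> by (simp add: mem_box bij_betw_def)
      then show ?thesis
        by (auto simp: mem_box T_inner p)
    qed
    then have "emeasure (distr lborel borel T) (box l u) = emeasure lborel (box (p l) (p u))"
      by (simp add: emeasure_distr)
    also have "\<dots> = ennreal (\<Prod>b\<in>Basis. (p u - p l) \<bullet> b)"
      using lu \<phi>B by (intro emeasure_lborel_box) (auto simp: p)
    also have "(\<Prod>b\<in>Basis. (p u - p l) \<bullet> b) = (\<Prod>b\<in>Basis. (u - l) \<bullet> \<phi> b)"
      by (intro prod.cong) (auto simp: p inner_diff_left)
    also have "\<dots> = (\<Prod>b\<in>Basis. (u - l) \<bullet> b)"
      by (rule prod.reindex_bij_betw[OF \<phi>])
    finally show "emeasure (distr lborel borel T) (box l u) = ennreal (\<Prod>b\<in>Basis. (u - l) \<bullet> b)" .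
  qed simp
  with lin inn show thesis
    by (intro that) auto
qed

text \<open>Polar coordinates for radial functions: both measures give \<open>{..a}\<close> the
  volume of the ball of radius \<open>a\<close>, and these half-lines form an intersection-stable
  generator of the Borel sets.\<close>

lemma distr_lborel_norm:
  "distr (lborel :: 'a::euclidean_space measure) borel norm =
     density lborel (\<lambda>r. ennreal (unit_ball_vol (DIM('a)) * (DIM('a) * r ^ (DIM('a) - 1))) * indicator {0..} r)"
    (is "?M = ?N")
proof (rule measure_eqI_generator_eq[where E = "range atMost" and \<Omega> = UNIV and A = "\<lambda>i. {..real i}"])
  show "Int_stable (range (atMost :: real \<Rightarrow> _))"
    by (auto simp: Int_stable_def)
  have M: "emeasure ?M {..a} = (if a < 0 then 0 else ennreal (unit_ball_vol (DIM('a)) * a ^ DIM('a)))" for a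
  proof -
    have "emeasure ?M {..a} = emeasure lborel (norm -` {..a} :: 'a set)"
      by (simp add: emeasure_distr)
    also have "norm -` {..a} = (cball 0 a :: 'a set)"
      by auto
    finally show ?thesis
      by (auto simp: emeasure_cball)
  qed
  have N: "emeasure ?N {..a} = (if a < 0 then 0 else ennreal (unit_ball_vol (DIM('a)) * a ^ DIM('a)))" for a
  proof (cases "a < 0")
    case True
    let ?f = "\<lambda>r::real. ennreal (unit_ball_vol (DIM('a)) * (DIM('a) * r ^ (DIM('a) - 1))) * indicator {0..} r"
    have "emeasure ?N {..a} = (\<integral>\<^sup>+r. ?f r * indicator {..a} r \<partial>lborel)"
      by (subst emeasure_density) auto
    also have "\<dots> = (\<integral>\<^sup>+(r::real). 0 \<partial>lborel)"
      using True by (intro nn_integral_cong) (auto simp: indicator_def)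
    finally show ?thesis
      using True by simp
  next
    case False
    let ?f = "\<lambda>r::real. unit_ball_vol (DIM('a)) * (DIM('a) * r ^ (DIM('a) - 1))"
    have "emeasure ?N {..a} = (\<integral>\<^sup>+r. ennreal (?f r) * indicator {0..a} r \<partial>lborel)"
      by (subst emeasure_density) (auto simp: indicator_def intro!: nn_integral_cong)
    also have "\<dots> = ennreal (unit_ball_vol (DIM('a)) * a ^ DIM('a) - unit_ball_vol (DIM('a)) * 0 ^ DIM('a))"
      using False by (intro nn_integral_FTC_Icc) (auto intro!: derivative_eq_intros)
    finally show ?thesis
      using False by simp
  qed
  show "emeasure ?M X = emeasure ?N X" if "X \<in> range atMost" for X
  proof -
    from that obtain a where "X = {..a}"
      by auto
    then show ?thesis
      by (simp only: M N)
  qed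
  show "emeasure ?M {..real i} \<noteq> \<infinity>" for i
    by (simp add: M)
  show "(\<Union>i. {..real i}) = UNIV"
    by (auto simp: real_arch_simple)
qed (auto simp: borel_eq_atMost)

lemma nn_integral_norm_lborel:
  assumes [measurable]: "f \<in> borel_measurable borel"
  shows "(\<integral>\<^sup>+x. f (norm (x :: 'a::euclidean_space)) \<partial>lborel) =
    (\<integral>\<^sup>+r. ennreal (unit_ball_vol (DIM('a)) * (DIM('a) * r ^ (DIM('a) - 1))) * indicator {0..} r * f r \<partial>lborel)"
proof -
  have "(\<integral>\<^sup>+x. f (norm (x :: 'a)) \<partial>lborel) = (\<integral>\<^sup>+r. f r \<partial>distr (lborel :: 'a measure) borel norm)"
    by (subst nn_integral_distr) auto
  then show ?thesis
    unfolding distr_lborel_norm by (simp add: nn_integral_density)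
qed

text \<open>Fubini: the slice over \<open>x\<close> is a ball of radius \<open>g (norm x)\<close>,
  and the remaining integrand is radial.\<close>

lemma emeasure_lborel_birevolution:
  fixes A :: "('a::euclidean_space \<times> 'b::euclidean_space) set"
  assumes A: "A \<in> sets borel" "A = {(x, y). norm x \<le> a \<and> norm y \<le> g (norm x)}"
    and [measurable]: "g \<in> borel_measurable borel"
    and g: "\<And>r. 0 \<le> r \<Longrightarrow> r \<le> a \<Longrightarrow> 0 \<le> g r"
    and J: "((\<lambda>r. r ^ (DIM('a) - 1) * g r ^ DIM('b)) has_integral J) {0..a}"
  shows "emeasure lborel A = ennreal (DIM('a) * unit_ball_vol (DIM('a)) * unit_ball_vol (DIM('b)) * J)"
proof -
  let ?\<alpha> = "unit_ball_vol (DIM('a))" and ?\<beta> = "unit_ball_vol (DIM('b))"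
  have "emeasure lborel A = (\<integral>\<^sup>+x. emeasure lborel (Pair x -` A) \<partial>lborel)"
    unfolding lborel_prod[symmetric]
    using A(1) by (intro lborel.emeasure_pair_measure_alt) (simp add: borel_prod[symmetric])
  also have "\<dots> = (\<integral>\<^sup>+x. (ennreal (?\<beta> * g (norm x) ^ DIM('b)) * indicator {..a} (norm x)) \<partial>(lborel :: 'a measure))"
  proof (intro nn_integral_cong)
    fix x :: 'a
    have "Pair x -` A = (if norm x \<le> a then cball 0 (g (norm x)) else {})"
      unfolding A(2) by auto
    then show "emeasure lborel (Pair x -` A) = ennreal (?\<beta> * g (norm x) ^ DIM('b)) * indicator {..a} (norm x)"
      by (simp add: emeasure_cball g)
  qed
  also have "\<dots> = (\<integral>\<^sup>+r. ennreal (?\<alpha> * (DIM('a) * r ^ (DIM('a) - 1))) * indicator {0..} r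
       * (ennreal (?\<beta> * g r ^ DIM('b)) * indicator {..a} r) \<partial>lborel)"
    by (rule nn_integral_norm_lborel) simp
  also have "\<dots> = (\<integral>\<^sup>+r. ennreal (DIM('a) * ?\<alpha> * ?\<beta> * (r ^ (DIM('a) - 1) * g r ^ DIM('b))) * indicator {0..a} r \<partial>lborel)"
    by (intro nn_integral_cong) (auto simp: indicator_def g ennreal_mult[symmetric] mult_ac)
  also have "\<dots> = ennreal (DIM('a) * ?\<alpha> * ?\<beta> * J)"
    using J by (intro nn_integral_has_integral_lebesgue' has_integral_mult_right) (auto simp: g)
  finally show ?thesis .
qed

section \<open>Integrals of the three pieces of the profile\<close>

lemma has_integral_mult_sqrt_diff_power:
  fixes a b c R :: real
  assumes "0 \<le> a" "a \<le> b" "b \<le> c"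
  shows "((\<lambda>r. (r - R) * sqrt (c\<^sup>2 - (r - R)\<^sup>2) ^ m) has_integral
     (sqrt (c\<^sup>2 - a\<^sup>2) ^ (m + 2) - sqrt (c\<^sup>2 - b\<^sup>2) ^ (m + 2)) / real (m + 2)) {R + a..R + b}"
proof -
  let ?F = "\<lambda>r. - (sqrt (c\<^sup>2 - (r - R)\<^sup>2) ^ (m + 2) / real (m + 2))"
  have "((\<lambda>r. (r - R) * sqrt (c\<^sup>2 - (r - R)\<^sup>2) ^ m) has_integral ?F (R + b) - ?F (R + a)) {R + a..R + b}"
  \<comment> \<open>The interior form is used because for \<open>b = c\<close> the square root is
    not differentiable at the right end.\<close>
  proof (rule fundamental_theorem_of_calculus_interior)
    fix r assume r: "r \<in> {R + a<..<R + b}"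
    have pos: "c\<^sup>2 - (r - R)\<^sup>2 > 0"
      using r assms power_strict_mono[of "r - R" c 2] by auto
    define s where "s = sqrt (c\<^sup>2 - (r - R)\<^sup>2)"
    have s: "s > 0"
      using pos by (simp add: s_def)
    have "((\<lambda>r. sqrt (c\<^sup>2 - (r - R)\<^sup>2)) has_real_derivative - (r - R) / s) (at r)"
      using pos s by (auto intro!: derivative_eq_intros simp: s_def[symmetric] field_simps)
    from DERIV_minus[OF DERIV_cdivide[OF DERIV_power[OF this, of "m + 2"], of "real (m + 2)"]]
    have "(?F has_real_derivative - (real (m + 2) * (- (r - R) / s * s ^ (m + 1)) / real (m + 2))) (at r)"
      by (simp add: s_def)
    also have "- (real (m + 2) * (- (r - R) / s * s ^ (m + 1)) / real (m + 2)) = (r - R) * s ^ m"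
      using s by simp (simp add: algebra_simps)
    finally show "(?F has_vector_derivative (r - R) * sqrt (c\<^sup>2 - (r - R)\<^sup>2) ^ m) (at r)"
      by (simp add: has_real_derivative_iff_has_vector_derivative s_def)
  qed (use assms in \<open>auto intro!: continuous_intros\<close>)
  then show ?thesis
    by (simp add: diff_divide_distrib)
qed

text \<open>The substitution \<open>r = R + c u\<close> scales out \<open>c\<close>. The remaining
  integral stays unevaluated; the final limit relies on a bound for it.\<close>

lemma has_integral_sqrt_diff_power:
  fixes a c R :: real
  assumes "0 \<le> a" "a \<le> 1" "0 \<le> c"
  shows "((\<lambda>r. sqrt (c\<^sup>2 - (r - R)\<^sup>2) ^ m) has_integral
     c ^ (m + 1) * integral {a..1} (\<lambda>u. sqrt (1 - u\<^sup>2) ^ m)) {R + c * a..R + c}"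
proof (cases "c = 0")
  case True
  then show ?thesis
    by (simp add: has_integral_refl)
next
  case False
  then have c: "c > 0"
    using assms by simp
  let ?I = "integral {a..1} (\<lambda>u. sqrt (1 - u\<^sup>2) ^ m)"
  have "(\<lambda>u. sqrt (1 - u\<^sup>2) ^ m) integrable_on {a..1}"
    by (intro integrable_continuous_real continuous_intros)
  then have "((\<lambda>u. sqrt (1 - u\<^sup>2) ^ m) has_integral ?I) (cbox a 1)"
    by (simp add: has_integral_integral)
  from has_integral_affinity[OF this, of "1 / c" "- R / c"]
  have "((\<lambda>r. sqrt (1 - ((r - R) / c)\<^sup>2) ^ m) has_integral c * ?I) ((\<lambda>x. c * x + R) ` {a..1})"
    using c by (simp add: diff_divide_distrib)
  moreover have "(\<lambda>x. c * x + R) ` {a..1} = {R + c * a..R + c}"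
    using c assms unfolding image_affinity_atLeastAtMost by (simp add: add.commute)
  ultimately have "((\<lambda>r. c ^ m * sqrt (1 - ((r - R) / c)\<^sup>2) ^ m) has_integral c ^ m * (c * ?I)) {R + c * a..R + c}"
    by (intro has_integral_mult_right) auto
  moreover have "c ^ m * sqrt (1 - ((r - R) / c)\<^sup>2) ^ m = sqrt (c\<^sup>2 - (r - R)\<^sup>2) ^ m" for r
  proof -
    have "c * sqrt (1 - ((r - R) / c)\<^sup>2) = sqrt (c\<^sup>2 * (1 - ((r - R) / c)\<^sup>2))"
      using c by (simp add: real_sqrt_mult)
    also have "c\<^sup>2 * (1 - ((r - R) / c)\<^sup>2) = c\<^sup>2 - (r - R)\<^sup>2"
      using c by (simp add: power_divide right_diff_distrib)
    finally show ?thesis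
      by (simp add: power_mult_distrib[symmetric])
  qed
  ultimately show ?thesis
    by (simp add: mult_ac)
qed

text \<open>Substituting \<open>t = (c - r/R)/S\<close> gives \<open>r = R (c - S t)\<close>, and
  \<open>F\<close> is an antiderivative of \<open>R^2 S t^m (c - S t)\<close>.\<close>

lemma has_integral_mult_linear_power:
  fixes R S c a b :: real and m :: nat
  assumes "R > 0" "S > 0" "a \<le> b"
  defines "F \<equiv> \<lambda>t. R\<^sup>2 * S * (c * t ^ (m + 1) / real (m + 1) - S * t ^ (m + 2) / real (m + 2))"
  shows "((\<lambda>r. r * ((c - r / R) / S) ^ m) has_integral F ((c - a / R) / S) - F ((c - b / R) / S)) {a..b}"
proof -
  have "((\<lambda>r. r * ((c - r / R) / S) ^ m) has_integral - F ((c - b / R) / S) - - F ((c - a / R) / S)) {a..b}"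
  proof (rule fundamental_theorem_of_calculus)
    fix r assume "r \<in> {a..b}"
    define t where "t = (c - r / R) / S"
    have "(F has_real_derivative R\<^sup>2 * S * (c * (real (m + 1) * (1 * t ^ (m + 1 - Suc 0))) / real (m + 1)
        - S * (real (m + 2) * (1 * t ^ (m + 2 - Suc 0))) / real (m + 2))) (at t)"
      unfolding F_def by (intro DERIV_cmult DERIV_diff DERIV_cdivide DERIV_power DERIV_ident)
    then have F: "(F has_real_derivative R\<^sup>2 * S * (c * (real (m + 1) * t ^ m) / real (m + 1)
        - S * (real (m + 2) * t ^ (m + 1)) / real (m + 2))) (at t)"
      by simp
    have "R\<^sup>2 * S * (c * (real (m + 1) * t ^ m) / real (m + 1) - S * (real (m + 2) * t ^ (m + 1)) / real (m + 2))
       = R\<^sup>2 * S * t ^ m * (c - S * t)"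
    proof -
      have "c * (real (m + 1) * t ^ m) / real (m + 1) = c * t ^ m"
        "S * (real (m + 2) * t ^ (m + 1)) / real (m + 2) = S * t ^ (m + 1)"
        by simp_all
      then show ?thesis
        by (simp only:) (simp add: algebra_simps)
    qed
    also have "c - S * t = r / R"
      using assms(1,2) by (simp add: t_def)
    also have "R\<^sup>2 * S * t ^ m * (r / R) = R * S * t ^ m * r"
      using assms(1) by (simp add: power2_eq_square)
    finally have F': "(F has_real_derivative R * S * t ^ m * r) (at t)"
      by (rule DERIV_cong[OF F])
    have "((\<lambda>r. (c - r / R) / S) has_real_derivative - 1 / (R * S)) (at r)"
      using assms(1,2) by (auto intro!: derivative_eq_intros)
    from DERIV_chain2[OF F'[unfolded t_def] this]
    have "((\<lambda>r. - F ((c - r / R) / S)) has_real_derivative - (R * S * t ^ m * r * (- 1 / (R * S)))) (at r)"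
      unfolding t_def by (rule DERIV_minus)
    also have "- (R * S * t ^ m * r * (- 1 / (R * S))) = r * t ^ m"
      using assms(1,2) by simp
    finally show "((\<lambda>r. - F ((c - r / R) / S)) has_vector_derivative r * ((c - r / R) / S) ^ m) (at r within {a..b})"
      unfolding t_def has_real_derivative_iff_has_vector_derivative by (rule has_vector_derivative_at_within)
  qed fact
  then show ?thesis by simp
qed

text \<open>The weight \<open>r\<close> is the polar density of a plane up to a constant.
  \<open>M\<close> arises from the tangent segment and \<open>I\<close> from the arc about the
  rim.\<close>

lemma has_integral_profile:
  fixes R \<rho> :: real and m :: nat
  assumes "R > 1" "\<rho> \<ge> 0"
  defines "M \<equiv> R\<^sup>2 * sqrt (1 - 1 / R\<^sup>2) ^ (m + 2) / real (m + 1)"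
    and "I \<equiv> integral {1 / R..1} (\<lambda>u. sqrt (1 - u\<^sup>2) ^ m)"
  shows "((\<lambda>r. r * profile R \<rho> r ^ m) has_integral
     ((1 + M) * (1 + \<rho>) ^ (m + 2) - real (m + 2) * (M - R * I) * \<rho> ^ (m + 1) - M * \<rho> ^ (m + 2)) / real (m + 2))
     {0..R + \<rho>}"
proof -
  define S where "S = sqrt (1 - 1 / R\<^sup>2)"
  define c where "c = 1 + \<rho>"
  have R2: "R\<^sup>2 > 1"
    using assms(1) by simp
  then have "1 / R\<^sup>2 < 1"
    by (subst divide_less_eq_1_pos) linarith+
  then have S2: "S\<^sup>2 = 1 - 1 / R\<^sup>2" and S: "S > 0"
    by (simp_all add: S_def)
  have sqS: "sqrt (x\<^sup>2 - (x / R)\<^sup>2) = x * S" if "x \<ge> 0" for x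
  proof -
    have "x\<^sup>2 - (x / R)\<^sup>2 = x\<^sup>2 * S\<^sup>2"
      unfolding S2 by (simp add: power_divide right_diff_distrib)
    then show ?thesis
      using that S by (simp add: real_sqrt_mult)
  qed
  have iR: "\<rho> / R \<le> \<rho>" "c / R \<le> c" "1 / R \<le> 1"
    using assms(1,2) by (auto simp: c_def divide_le_eq intro: mult_left_mono[of 1 R, simplified])
  have c1: "0 \<le> c / R" "c / R \<le> R + \<rho> / R"
  proof -
    have "c / R = 1 / R + \<rho> / R"
      by (simp add: c_def add_divide_distrib)
    moreover have "1 / R \<le> R"
      using iR(3) assms(1) by linarith
    ultimately show "0 \<le> c / R" "c / R \<le> R + \<rho> / R"
      using assms(1,2) by auto
  qed
  let ?f = "\<lambda>r. r * profile R \<rho> r ^ m"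
  have 1: "(?f has_integral (c ^ (m + 2) - (c * S) ^ (m + 2)) / real (m + 2)) {0..c / R}"
  proof (rule has_integral_eq)
    show "((\<lambda>r. r * sqrt (c\<^sup>2 - r\<^sup>2) ^ m) has_integral (c ^ (m + 2) - (c * S) ^ (m + 2)) / real (m + 2)) {0..c / R}"
      using has_integral_mult_sqrt_diff_power[of 0 "c / R" c 0 m] iR c1 sqS[of c] assms by (simp add: c_def)
  qed (auto simp: profile_def c_def)
  define F where "F = (\<lambda>t. R\<^sup>2 * S * (c * t ^ (m + 1) / real (m + 1) - S * t ^ (m + 2) / real (m + 2)))"
  have 2: "(?f has_integral F (c * S) - F (\<rho> * S)) {c / R..R + \<rho> / R}"
  \<comment> \<open>At the breakpoint \<open>profile\<close> still follows the preceding branch, so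
    the formula is matched off that point; likewise for the last piece.\<close>
  proof (rule has_integral_spike_finite[of "{c / R}"])
    have "c - (c / R) / R = c * S\<^sup>2"
      unfolding S2 by (simp add: right_diff_distrib power2_eq_square)
    then have "(c - (c / R) / R) / S = c * S"
      using S by (simp add: power2_eq_square)
    moreover have "c - (R + \<rho> / R) / R = \<rho> * S\<^sup>2"
      unfolding S2 using assms(1)
      by (simp add: c_def add_divide_distrib right_diff_distrib power2_eq_square)
    then have "(c - (R + \<rho> / R) / R) / S = \<rho> * S"
      using S by (simp add: power2_eq_square)
    ultimately show "((\<lambda>r. r * ((c - r / R) / S) ^ m) has_integral F (c * S) - F (\<rho> * S)) {c / R..R + \<rho> / R}"
      using has_integral_mult_linear_power[of R S "c / R" "R + \<rho> / R" c m] assms(1) S c1 by (simp add: F_def)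
  qed (auto simp: profile_def c_def S_def)
  have 3: "(?f has_integral (\<rho> * S) ^ (m + 2) / real (m + 2) + R * (\<rho> ^ (m + 1) * I)) {R + \<rho> / R..R + \<rho>}"
  proof (rule has_integral_spike_finite[of "{R + \<rho> / R}"])
    have a: "((\<lambda>r. (r - R) * sqrt (\<rho>\<^sup>2 - (r - R)\<^sup>2) ^ m) has_integral (\<rho> * S) ^ (m + 2) / real (m + 2)) {R + \<rho> / R..R + \<rho>}"
      using has_integral_mult_sqrt_diff_power[of "\<rho> / R" \<rho> \<rho> R m] iR assms(1,2) sqS[of \<rho>] by simp
    have b: "((\<lambda>r. R * sqrt (\<rho>\<^sup>2 - (r - R)\<^sup>2) ^ m) has_integral R * (\<rho> ^ (m + 1) * I)) {R + \<rho> / R..R + \<rho>}"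
      using has_integral_sqrt_diff_power[of "1 / R" \<rho> R m] iR assms(1,2) unfolding I_def
      by (intro has_integral_mult_right) simp
    show "((\<lambda>r. r * sqrt (\<rho>\<^sup>2 - (r - R)\<^sup>2) ^ m) has_integral
        (\<rho> * S) ^ (m + 2) / real (m + 2) + R * (\<rho> ^ (m + 1) * I)) {R + \<rho> / R..R + \<rho>}"
      by (rule has_integral_eq[OF _ has_integral_add[OF a b]]) (simp add: left_diff_distrib)
    show "?f r = r * sqrt (\<rho>\<^sup>2 - (r - R)\<^sup>2) ^ m" if "r \<in> {R + \<rho> / R..R + \<rho>} - {R + \<rho> / R}" for r
      using that c1(2) by (auto simp: profile_def c_def)
  qed simp
  have "(?f has_integral (c ^ (m + 2) - (c * S) ^ (m + 2)) / real (m + 2) + (F (c * S) - F (\<rho> * S))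
      + ((\<rho> * S) ^ (m + 2) / real (m + 2) + R * (\<rho> ^ (m + 1) * I))) {0..R + \<rho>}"
    using c1 iR by (intro has_integral_combine[OF _ _ has_integral_combine[OF _ _ 1 2] 3]) auto
  moreover have "(c ^ (m + 2) - (c * S) ^ (m + 2)) / real (m + 2) + (F (c * S) - F (\<rho> * S))
      + ((\<rho> * S) ^ (m + 2) / real (m + 2) + R * (\<rho> ^ (m + 1) * I)) =
      ((1 + M) * c ^ (m + 2) - real (m + 2) * (M - R * I) * \<rho> ^ (m + 1) - M * \<rho> ^ (m + 2)) / real (m + 2)"
  proof -
    \<comment> \<open>Because \<open>R^2 S^2 = R^2 - 1\<close>, the \<open>X\<close> terms of the
      two arcs cancel those of the segment, and only \<open>M\<close> and \<open>I\<close>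
      remain.\<close>
    define X where "X = S ^ (m + 2)"
    have M: "M = R\<^sup>2 * X / real (m + 1)"
      by (simp add: M_def X_def S_def)
    have RS: "R\<^sup>2 * S\<^sup>2 = R\<^sup>2 - 1"
      unfolding S2 using assms(1) by (simp add: right_diff_distrib)
    have F: "F (t * S) = c * t ^ (m + 1) * M - (R\<^sup>2 - 1) * X * t ^ (m + 2) / real (m + 2)" for t
    proof -
      have "F (t * S) = c * t ^ (m + 1) * (R\<^sup>2 * X / real (m + 1)) - (R\<^sup>2 * S\<^sup>2) * X * t ^ (m + 2) / real (m + 2)"
        unfolding F_def X_def by (simp add: power_mult_distrib power2_eq_square algebra_simps del: of_nat_Suc of_nat_add)
      then show ?thesis
        by (simp only: RS M)
    qed
    have RX: "R\<^sup>2 * X = M * real (m + 1)"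
      by (simp add: M)
    define k where "k = real (m + 2)"
    have k: "k > 0" "real (m + 1) = k - 1"
      by (auto simp: k_def)
    have e1: "(R\<^sup>2 - 1) * X = M * (k - 1) - X"
      using RX k(2) by (simp add: left_diff_distrib)
    show ?thesis
      unfolding F e1 power_mult_distrib X_def[symmetric] k_def[symmetric] using k(1)
      by (simp add: c_def field_simps)
  qed
  ultimately show ?thesis
    by (simp add: c_def)
qed

lemma measurable_profile [measurable]: "profile R \<rho> \<in> borel_measurable borel"
  unfolding profile_def by measurable

lemma profile_nonneg:
  assumes "R > 1" "\<rho> \<ge> 0" "0 \<le> r" "r \<le> R + \<rho>"
  shows "0 \<le> profile R \<rho> r"
proof -
  have R2: "R\<^sup>2 > 1"
    using assms(1) by simp
  consider "r \<le> (1 + \<rho>) / R" | "r > (1 + \<rho>) / R" "r \<le> R + \<rho> / R" | "r > (1 + \<rho>) / R" "r > R + \<rho> / R"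
    by linarith
  then show ?thesis
  proof cases
    case 1
    then have "r \<le> 1 + \<rho>"
      using assms by (smt (verit) divide_le_eq_1_pos mult_left_le frac_le div_by_1)
    with 1 assms show ?thesis
      by (simp add: profile_def power_mono)
  next
    case 2
    have "r / R \<le> (R + \<rho>) / R"
      using assms by (simp add: divide_right_mono)
    also have "\<dots> \<le> 1 + \<rho>"
      using assms mult_left_mono[of 1 R \<rho>] by (simp add: field_simps)
    finally have "r / R \<le> 1 + \<rho>" .
    moreover have "1 / R\<^sup>2 \<le> 1"
      using R2 by (subst divide_le_eq_1_pos) linarith+
    ultimately show ?thesis
      using 2 by (simp add: profile_def)
  next
    case 3
    have "R < r"
      using 3 assms by (smt (verit) divide_nonneg_pos)
    then show ?thesis
      using 3 assms by (auto simp: profile_def intro!: power_mono)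
  qed
qed

section \<open>The Steiner polynomial\<close>

text \<open>Steiner coefficients are unique, so the volumes for \<open>\<rho> \<ge> 0\<close>
  identify the polynomial; the binomial factors divided out here reappear in
  \<open>steiner_poly\<close>.\<close>

lemma steiner_poly_eqI:
  fixes K E :: "'a::euclidean_space set"
  assumes "degree q \<le> DIM('a)"
    and "\<And>\<rho>. \<rho> \<ge> 0 \<Longrightarrow> measure lebesgue (K + (\<lambda>y. \<rho> *\<^sub>R y) ` E) = poly q \<rho>"
  shows "steiner_poly K E = map_poly of_real q"
proof -
  have "quermassintegral K E = (\<lambda>i. coeff q i / real (DIM('a) choose i))"
  proof (rule quermassintegral_eqI, unfold steiner_coeffs_def, intro conjI allI impI)
    fix i assume "i > DIM('a)"
    then show "coeff q i / real (DIM('a) choose i) = 0"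
      by simp
  next
    fix \<rho> :: real assume "\<rho> \<ge> 0"
    then have "measure lebesgue (K + (\<lambda>y. \<rho> *\<^sub>R y) ` E) = (\<Sum>i\<le>DIM('a). coeff q i * \<rho> ^ i)"
      using assms unfolding poly_altdef
      by (simp, intro sum.mono_neutral_left) (auto simp: coeff_eq_0)
    then show "measure lebesgue (K + (\<lambda>y. \<rho> *\<^sub>R y) ` E) =
        (\<Sum>i\<le>DIM('a). real (DIM('a) choose i) * (coeff q i / real (DIM('a) choose i)) * \<rho> ^ i)"
      by simp
  qed
  then have "steiner_poly K E = (\<Sum>i\<le>DIM('a). monom (of_real (coeff q i)) i)"
    by (simp add: steiner_poly_def)
  also have "\<dots> = map_poly of_real q"
    using assms(1) by (intro poly_eqI) (auto simp: coeff_sum coeff_map_poly coeff_eq_0)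
  finally show ?thesis .
qed

text \<open>\<open>T\<close> is a measure-preserving isometry taking the first factor to
  \<open>U\<close>, so the preimage of the sum is a region of birevolution bounded by
  \<open>profile\<close>.\<close>

lemma measure_hull_ball_disc_plus_cball:
  fixes T :: "'a::euclidean_space \<times> 'b::euclidean_space \<Rightarrow> 'c::euclidean_space"
  assumes T: "linear T" "\<And>v w. T v \<bullet> T w = v \<bullet> w" "distr lborel borel T = lborel"
    and 2: "DIM('a) = 2" and "R > 1" "\<rho> \<ge> 0"
  defines "U \<equiv> T ` (UNIV \<times> {0})"
    and "M \<equiv> R\<^sup>2 * sqrt (1 - 1 / R\<^sup>2) ^ (DIM('b) + 2) / real (DIM('b) + 1)"
    and "I \<equiv> integral {1 / R..1} (\<lambda>u. sqrt (1 - u\<^sup>2) ^ DIM('b))"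
  shows "measure lebesgue (convex hull (cball 0 1 \<union> (U \<inter> cball 0 R)) + (\<lambda>y. \<rho> *\<^sub>R y) ` cball 0 1) =
     2 * unit_ball_vol 2 * unit_ball_vol (DIM('b)) *
     (((1 + M) * (1 + \<rho>) ^ (DIM('b) + 2) - real (DIM('b) + 2) * (M - R * I) * \<rho> ^ (DIM('b) + 1)
       - M * \<rho> ^ (DIM('b) + 2)) / real (DIM('b) + 2))"
    (is "measure lebesgue ?A = 2 * _ * _ * ?J")
proof -
  have U: "subspace U"
    unfolding U_def using T(1) by (intro linear_subspace_image subspace_Times) auto
  have nT: "norm (T v) = norm v" for v
    by (simp add: norm_eq_sqrt_inner T(2))
  have [measurable]: "T \<in> borel_measurable borel"
    using T(1) by (intro borel_measurable_continuous_onI linear_continuous_on) (simp add: linear_conv_bounded_linear)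
  \<comment> \<open>Compactness makes the sum Borel, so that its Lebesgue measure can be computed in
    \<open>lborel\<close>.\<close>
  have "compact ?A"
  proof -
    have "compact (convex hull (cball 0 1 \<union> (U \<inter> cball 0 R)))"
      using convex_body_hull_ball_disc[OF U] by (simp add: convex_body_def)
    from compact_sums[OF this compact_scaling[OF compact_cball[of 0 1], of \<rho>]]
    show ?thesis
      by (rule back_subst[of compact]) (auto simp: set_plus_def)
  qed
  then have A[measurable]: "?A \<in> sets borel"
    by (rule borel_compact)
  let ?B = "{(x :: 'a, y :: 'b). norm x \<le> R + \<rho> \<and> norm y \<le> profile R \<rho> (norm x)}"
  have pre: "T -` ?A = ?B"
  proof -
    have "T (x, y) \<in> ?A \<longleftrightarrow> norm x \<le> R + \<rho> \<and> norm y \<le> profile R \<rho> (norm x)" for x y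
    proof -
      have "T (x, y) = T (x, 0) + T (0, y)"
        using linear_add[OF T(1), of "(x, 0)" "(0, y)"] by simp
      moreover have "T (x, 0) \<in> U"
        by (auto simp: U_def)
      moreover have "orthogonal u (T (0, y))" if "u \<in> U" for u
        using that by (auto simp: U_def orthogonal_def T(2))
      ultimately show ?thesis
        using mem_hull_ball_disc_plus_cball_iff[OF U, of "T (x, 0)" "T (0, y)" R \<rho>] assms(5,6)
        by (simp add: nT norm_Pair)
    qed
    then show ?thesis
      by auto
  qed
  have "emeasure lborel ?A = emeasure (distr lborel borel T) ?A"
    by (simp add: T(3))
  also have "\<dots> = emeasure lborel ?B"
    using A by (simp add: emeasure_distr pre)
  also have "\<dots> = ennreal (DIM('a) * unit_ball_vol (DIM('a)) * unit_ball_vol (DIM('b)) * ?J)"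
  proof (rule emeasure_lborel_birevolution[OF _ refl])
    have "T -` ?A \<inter> space borel \<in> sets borel"
      by (rule measurable_sets[OF _ A]) simp
    then show "?B \<in> sets borel"
      by (simp add: pre)
    show "((\<lambda>r. r ^ (DIM('a) - 1) * profile R \<rho> r ^ DIM('b)) has_integral ?J) {0..R + \<rho>}"
      using has_integral_profile[OF assms(5,6), of "DIM('b)"] by (simp add: 2 M_def I_def)
  qed (use profile_nonneg assms(5,6) in auto)
  finally have "emeasure lborel ?A = ennreal (DIM('a) * unit_ball_vol (DIM('a)) * unit_ball_vol (DIM('b)) * ?J)" .
  moreover have "0 \<le> ?J"
    using has_integral_profile[OF assms(5,6), of "DIM('b)"]
    unfolding M_def I_def by (rule has_integral_nonneg) (use profile_nonneg assms(5,6) in auto)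
  then have "0 \<le> DIM('a) * unit_ball_vol (DIM('a)) * unit_ball_vol (DIM('b)) * ?J"
    by (intro mult_nonneg_nonneg) auto
  moreover have "measure lebesgue ?A = enn2real (emeasure lborel ?A)"
    using A by (simp add: measure_completion measure_def)
  ultimately have "measure lebesgue ?A = DIM('a) * unit_ball_vol (DIM('a)) * unit_ball_vol (DIM('b)) * ?J"
    by (simp only: enn2real_ennreal)
  then show ?thesis
    by (simp only: 2 of_nat_numeral)
qed

lemma map_poly_of_real_limit:
  "map_poly complex_of_real (smult k (smult (1 + a) ([:1, 1:] ^ n) - monom b m - monom c n)) =
    smult (of_real k) (smult (1 + of_real a) ([:1, 1:] ^ n) - monom (of_real b) m - monom (of_real c) n)"
proof -
  have "complex_of_real (coeff ([:1, 1:] ^ n) i) = coeff ([:1, 1:] ^ n) i" for i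
    by (cases "i \<le> n") (simp_all add: coeff_linear_poly_power coeff_eq_0 degree_linear_power)
  then show ?thesis
    by (intro poly_eqI) (simp add: coeff_map_poly)
qed

text \<open>The root itself is not followed. At the fixed point \<open>w\<close> the real part is
  continuous in the coefficients and stays negative, which contradicts
  \<open>Re_pderiv_mult_cnj_nonneg\<close> unless some root has positive real part. In the
  application \<open>a\<close> is \<open>1/M\<close> and \<open>b\<close> is
  \<open>R I/M\<close>.\<close>

lemma eventually_root_Re_pos:
  fixes a b :: "real \<Rightarrow> real"
  assumes "(a \<longlongrightarrow> 0) F" "(b \<longlongrightarrow> 0) F"
  shows "\<forall>\<^sub>F x in F. \<exists>s. poly (smult (1 + of_real (a x)) ([:1, 1:] ^ 15)
     - monom (of_real (15 * (1 - b x))) 14 - monom 1 15) s = 0 \<and> Re s > 0"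
proof -
  define w where "w = Complex (1/80) (140/80)"
  let ?p = "\<lambda>x. smult (1 + of_real (a x)) ([:1, 1:] ^ 15)
     - monom (of_real (15 * (1 - b x))) 14 - monom 1 15 :: complex poly"
  let ?d = "\<lambda>x. Re ((15 * (1 + of_real (a x)) * (1 + w) ^ 14 - 210 * (1 - of_real (b x)) * w ^ 13 - 15 * w ^ 14) *
   cnj ((1 + of_real (a x)) * (1 + w) ^ 15 - 15 * (1 - of_real (b x)) * w ^ 14 - w ^ 15))"
  have "(?d \<longlongrightarrow> Re ((15 * (1 + of_real 0) * (1 + w) ^ 14 - 210 * (1 - of_real 0) * w ^ 13 - 15 * w ^ 14) *
   cnj ((1 + of_real 0) * (1 + w) ^ 15 - 15 * (1 - of_real 0) * w ^ 14 - w ^ 15))) F"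
    by (intro tendsto_intros assms)
  moreover have "Re ((15 * (1 + of_real 0) * (1 + w) ^ 14 - 210 * (1 - of_real 0) * w ^ 13 - 15 * w ^ 14) *
   cnj ((1 + of_real 0) * (1 + w) ^ 15 - 15 * (1 - of_real 0) * w ^ 14 - w ^ 15)) < 0"
    using Re_pderiv_limit_neg by (simp add: w_def)
  ultimately have "\<forall>\<^sub>F x in F. ?d x < 0"
    by (rule order_tendstoD(2))
  then show ?thesis
  proof eventually_elim
    case (elim x)
    have "poly (?p x) w = (1 + of_real (a x)) * (1 + w) ^ 15 - 15 * (1 - of_real (b x)) * w ^ 14 - w ^ 15"
      by (simp add: poly_monom)
    moreover have "poly (pderiv (?p x)) w = 15 * (1 + of_real (a x)) * (1 + w) ^ 14 - 210 * (1 - of_real (b x)) * w ^ 13 - 15 * w ^ 14"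
      by (simp add: poly_monom pderiv_diff pderiv_smult pderiv_power pderiv_monom pderiv_pCons)
    ultimately have "Re (poly (pderiv (?p x)) w * cnj (poly (?p x) w)) < 0"
      using elim by (simp only:)
    moreover have "Re w \<ge> 0"
      by (simp add: w_def)
    ultimately show ?case
      using Re_pderiv_mult_cnj_nonneg[of "?p x" w] by (meson not_le)
  qed
qed

theorem theorem1p2:
  "\<exists>K :: (real^15) set.
     convex_body K \<and> tangential_body 2 K (cball 0 1) \<and>
     (\<exists>s :: complex. poly (steiner_poly K (cball 0 1)) s = 0 \<and> Re s > 0)"
proof -
  \<comment> \<open>The splitting 15 = 2 + 13 separates the plane \<open>U\<close> from its
    complement; 14 and 15 below are \<open>m + 1\<close> and \<open>m + 2\<close> for
    \<open>m = 13\<close>.\<close>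
  obtain T :: "(real^2) \<times> (real^13) \<Rightarrow> real^15"
    where T: "linear T" "\<And>v w. T v \<bullet> T w = v \<bullet> w" "distr lborel borel T = lborel"
    using lborel_isometry_exists[where 'a = "(real^2) \<times> (real^13)" and 'b = "real^15"] by auto
  define U where "U = T ` (UNIV \<times> {0})"
  have U: "subspace U"
    unfolding U_def using T(1) by (intro linear_subspace_image subspace_Times) auto
  have "inj T"
    unfolding linear_injective_0[OF T(1)] by (metis T(2) inner_eq_zero_iff)
  then have dimU: "dim U = 2"
    unfolding U_def
    by (simp add: dim_image_eq[OF T(1) inj_on_subset[OF \<open>inj T\<close> subset_UNIV]] dim_Times)
  define M where "M R = R\<^sup>2 * sqrt (1 - 1 / R\<^sup>2) ^ 15 / 14" for R :: real
  define I where "I R = integral {1 / R..1} (\<lambda>u. sqrt (1 - u\<^sup>2) ^ 13)" for R :: real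
  have lim: "((\<lambda>R. 1 / R) \<longlongrightarrow> (0 :: real)) at_top"
    using tendsto_inverse_0_at_top[OF filterlim_ident] by (simp add: inverse_eq_divide)
  \<comment> \<open>Written in terms of \<open>1/R\<close>, the quotient shows that \<open>M\<close>
    grows like \<open>R^2/14\<close>.\<close>
  have "((\<lambda>R. 14 * (1 / R)\<^sup>2 / sqrt (1 - (1 / R)\<^sup>2) ^ 15) \<longlongrightarrow> 14 * 0\<^sup>2 / sqrt (1 - 0\<^sup>2) ^ 15) at_top"
    by (intro tendsto_intros lim) auto
  then have lim_a: "((\<lambda>R. 1 / M R) \<longlongrightarrow> 0) at_top"
    by (simp add: M_def power_one_over)
  have "((\<lambda>R. 14 * (1 / R) / sqrt (1 - (1 / R)\<^sup>2) ^ 15) \<longlongrightarrow> 14 * 0 / sqrt (1 - 0\<^sup>2) ^ 15) at_top"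
    by (intro tendsto_intros lim) auto
  moreover have "R / M R = 14 * (1 / R) / sqrt (1 - (1 / R)\<^sup>2) ^ 15" for R
    by (simp add: M_def power_one_over power2_eq_square)
  ultimately have lim_b: "((\<lambda>R. R / M R) \<longlongrightarrow> 0) at_top"
    by simp
  \<comment> \<open>The integrand lies between 0 and 1 on an interval of length below 1.\<close>
  have I: "\<bar>I R\<bar> \<le> 1" if "R > 1" for R
  proof -
    have "norm (integral (cbox (1 / R) 1) (\<lambda>u. sqrt (1 - u\<^sup>2) ^ 13)) \<le> 1 * measure lborel (cbox (1 / R) 1)"
    proof (rule integrable_bound)
      show "(\<lambda>u. sqrt (1 - u\<^sup>2) ^ 13) integrable_on cbox (1 / R) 1"
        by (intro integrable_continuous continuous_intros)
      fix u assume "u \<in> cbox (1 / R) 1"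
      then have "1 / R \<le> u" "u \<le> 1"
        by auto
      moreover have "0 < 1 / R"
        using that by simp
      ultimately have "0 \<le> u" "u \<le> 1"
        by linarith+
      then show "norm (sqrt (1 - u\<^sup>2) ^ 13) \<le> 1"
        by (simp add: power_le_one)
    qed simp
    also have "\<dots> \<le> 1"
      using that by simp
    finally show ?thesis
      by (simp add: I_def)
  qed
  have "((\<lambda>R. R * I R / M R) \<longlongrightarrow> 0) at_top"
  proof (rule Lim_null_comparison)
    show "\<forall>\<^sub>F R in at_top. norm (R * I R / M R) \<le> \<bar>R / M R\<bar>"
      using eventually_gt_at_top[of 1]
    proof eventually_elim
      case (elim R)
      then show ?case
        using mult_left_mono[OF I[OF elim], of "\<bar>R / M R\<bar>"] by (simp add: abs_mult)
    qed
    show "((\<lambda>R. \<bar>R / M R\<bar>) \<longlongrightarrow> 0) at_top"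
      using lim_b by (rule tendsto_rabs_zero)
  qed
  from eventually_root_Re_pos[OF lim_a this] eventually_gt_at_top[of 1]
  have "\<forall>\<^sub>F R in at_top. R > 1 \<and> (\<exists>s. poly (smult (1 + of_real (1 / M R)) ([:1, 1:] ^ 15)
     - monom (of_real (15 * (1 - R * I R / M R))) 14 - monom 1 15) s = 0 \<and> Re s > 0)"
    by eventually_elim blast
  then obtain R s where R: "R > 1" and s: "Re s > 0"
    "poly (smult (1 + of_real (1 / M R)) ([:1, 1:] ^ 15)
     - monom (of_real (15 * (1 - R * I R / M R))) 14 - monom 1 15) s = 0"
    using eventually_happens'[OF trivial_limit_at_top_linorder] by blast
  let ?K = "convex hull (cball 0 1 \<union> (U \<inter> cball 0 R))"
  \<comment> \<open>\<open>k\<close> collects the volume constants, the divisor 15 and the factor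
    \<open>M\<close>; dividing by it leaves the perturbed limit polynomial.\<close>
  define k where "k = 2 * unit_ball_vol 2 * unit_ball_vol 13 * M R / 15"
  let ?q = "smult k (smult (1 + 1 / M R) ([:1, 1:] ^ 15) - monom (15 * (1 - R * I R / M R)) 14 - monom 1 15)"
  have "1 / R\<^sup>2 < 1"
    using R by (simp add: power_one_over)
  then have M: "M R > 0"
    using R by (simp add: M_def)
  have "steiner_poly ?K (cball 0 1) = map_poly of_real ?q"
  proof (rule steiner_poly_eqI)
    show "degree ?q \<le> DIM(real^15)"
      by (intro order_trans[OF degree_smult_le] degree_diff_le order_trans[OF degree_power_le] order_trans[OF degree_monom_le]) auto
    fix \<rho> :: real assume "\<rho> \<ge> 0"
    then have "measure lebesgue (?K + (\<lambda>y. \<rho> *\<^sub>R y) ` cball 0 1) = 2 * unit_ball_vol 2 * unit_ball_vol 13 *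
        (((1 + M R) * (1 + \<rho>) ^ 15 - 15 * (M R - R * I R) * \<rho> ^ 14 - M R * \<rho> ^ 15) / 15)"
      using measure_hull_ball_disc_plus_cball[OF T _ R, of \<rho>] by (simp add: U_def M_def I_def)
    also have "\<dots> = k * ((1 + 1 / M R) * (1 + \<rho>) ^ 15 - 15 * (1 - R * I R / M R) * \<rho> ^ 14 - \<rho> ^ 15)"
    proof -
      have "c * (((1 + x) * u - 15 * (x - y) * v - x * z) / 15)
          = c * x / 15 * ((1 + 1 / x) * u - 15 * (1 - y / x) * v - z)" if "x > 0" for c x y u v z :: real
        using that by (simp add: field_simps)
      from this[OF M] show ?thesis
        by (simp only: k_def)
    qed
    also have "\<dots> = poly ?q \<rho>"
      by (simp add: poly_monom)
    finally show "measure lebesgue (?K + (\<lambda>y. \<rho> *\<^sub>R y) ` cball 0 1) = poly ?q \<rho>" .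
  qed
  moreover have "poly (map_poly of_real ?q) s = 0"
    unfolding map_poly_of_real_limit using s by simp
  moreover have "tangential_body 2 ?K (cball 0 1)"
    using tangential_body_hull_ball_disc[OF U, of R] R by (simp add: dimU)
  ultimately show ?thesis
    using convex_body_hull_ball_disc[OF U] s by metis
qed

end
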